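(* Let $p \ge 3$ be a prime. There exists a solution $(x,y,z)$ for $p$ with $y = z$ if and only if $p \equiv 3 \pmod 4$. Moreover, any such solution is $(u, 2up, 2up)$ with $u = \frac{p+1}{4}$.
   Context: For a positive integer $p$, a solution for $p$ is a triple $(x,y,z)$ of positive integers with $x \le y \le z$ and $\frac{4}{p} = \frac{1}{x} + \frac{1}{y} + \frac{1}{z}$. *)

theory Defs
  imports Complex_Main "HOL-Computational_Algebra.Primes" "HOL-Number_Theory.Cong"
begin

definition is_solution :: "nat \<Rightarrow> nat \<times> nat \<times> nat \<Rightarrow> bool" where
  "is_solution p = (\<lambda>(x, y, z). 0 < x \<and> x \<le> y \<and> y \<le> z \<and>
     4 / real p = 1 / real x + 1 / real y + 1 / real z)"

end

(* Clearing denominators in 4/p = 1/x + 2/y gives (4x - p)(2y - p) = p^2 with both factors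
   positive, so 4x - p is 1, p or p^2. Parity excludes p, the condition x \<le> y excludes p^2,
   and 4x - p = 1 is the claimed solution. *)
theory Submission
  imports Defs
begin

text \<open>Multiplying by \<open>p * x * y\<close> turns the real equation into one over the
  naturals, where divisibility arguments apply.\<close>

lemma is_solution_diag_iff:
  assumes "p > 0"
  shows "is_solution p (x, y, y) \<longleftrightarrow> 0 < x \<and> x \<le> y \<and> 4 * x * y = p * y + 2 * p * x"
proof (cases "0 < x \<and> x \<le> y")
  case True
  then have "4 / real p = 1 / real x + 1 / real y + 1 / real y \<longleftrightarrow>
      real (4 * x * y) = real (p * y + 2 * p * x)"
    using assms by (auto simp: field_simps)
  then show ?thesis
    using True unfolding is_solution_def of_nat_eq_iff by simp
qed (auto simp: is_solution_def)

lemma diag_solution_unique: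
  fixes p x y :: nat
  assumes p: "prime p" "p \<ge> 3" and x: "0 < x" "x \<le> y"
    and eq: "4 * x * y = p * y + 2 * p * x"
  shows "4 * x = p + 1 \<and> y = 2 * x * p"
proof -
  \<comment> \<open>Each bound drops one positive summand from the right side of \<open>eq\<close>.
    Naming the excesses \<open>a\<close> and \<open>b\<close> then avoids truncated
    subtraction.\<close>
  have "p * y < 4 * x * y" "x * (2 * p) < x * (4 * y)"
    using p x eq by (auto simp: algebra_simps)
  then have "p < 4 * x" "p < 2 * y"
    by auto
  then obtain a b where a: "4 * x = p + a" and b: "2 * y = p + b"
    by (metis less_imp_add_positive)
  \<comment> \<open>Doubling \<open>eq\<close> makes both sides expressions in \<open>4 * x\<close>
    and \<open>2 * y\<close>; cancelling the common terms leaves \<open>a * b\<close> equal to the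
    square of \<open>p\<close>.\<close>
  have "(p + a) * (p + b) = 2 * (4 * x * y)"
    unfolding a[symmetric] b[symmetric] by simp
  also have "\<dots> = p * (p + b) + p * (p + a)"
    unfolding eq a[symmetric] b[symmetric] by (simp add: algebra_simps)
  finally have ab: "a * b = p\<^sup>2"
    by (simp add: algebra_simps power2_eq_square)
  then have "a dvd p ^ 2"
    by (metis dvd_triv_left)
  then obtain i where i: "i \<le> 2" "a = p ^ i"
    using divides_primepow_nat[OF p(1)] by blast
  from i(1) consider "i = 0" | "i = 1" | "i = 2"
    by linarith
  then show ?thesis
  proof cases
    case 1
    then have x_eq: "4 * x = p + 1" and "2 * y = p * (p + 1)"
      using i a b ab by (simp_all add: power2_eq_square)
    then have "2 * y = p * (4 * x)"
      by (simp only:)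
    also have "\<dots> = 2 * (2 * x * p)"
      by simp
    finally have "y = 2 * x * p"
      by simp
    with x_eq show ?thesis
      by (rule conjI)
  next
    case 2
    then have "p = 2 * x"
      using a i by simp
    moreover have "odd p"
      using p by (intro prime_odd_nat) auto
    ultimately show ?thesis
      by simp
  next
    case 3
    \<comment> \<open>Now \<open>4 * x = p * (p + 1)\<close> and \<open>2 * y = p + 1\<close>, so
      \<open>x \<le> y\<close>, multiplied by 4, bounds \<open>p\<close> by 2.\<close>
    then have "b = 1"
      using ab i p by simp
    then have "p * (p + 1) \<le> 2 * (p + 1)"
      using 3 i a b x(2) by (simp add: power2_eq_square)
    then have "p \<le> 2"
      by (simp only: mult_le_cancel2)
    then show ?thesis
      using p(2) by simp
  qed
qed

theorem mainTheorem5: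
  fixes p :: nat
  assumes "prime p" and "p \<ge> 3"
  shows "((\<exists>x y z. is_solution p (x, y, z) \<and> y = z) \<longleftrightarrow> [p = 3] (mod 4)) \<and>
    (\<forall>x y z. is_solution p (x, y, z) \<and> y = z \<longrightarrow>
       (\<exists>u::nat. real u = (real p + 1) / 4 \<and> (x, y, z) = (u, 2 * u * p, 2 * u * p)))"
proof -
  have p: "p > 0"
    using assms(2) by simp
  have unique: "4 * x = p + 1 \<and> y = 2 * x * p" if "is_solution p (x, y, y)" for x y
    using that diag_solution_unique[OF assms] is_solution_diag_iff[OF p] by blast
  have cong: "[p = 3] (mod 4)" if "is_solution p (x, y, y)" for x y
    using unique[OF that] unfolding cong_def by presburger
  have "\<exists>x y. is_solution p (x, y, y)" if "[p = 3] (mod 4)"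
  proof -
    have "4 dvd p + 1"
      using that unfolding cong_def by presburger
    then obtain u where u: "p + 1 = 4 * u" ..
    \<comment> \<open>Replacing the factor \<open>4 * u\<close> by \<open>p + 1\<close> splits the
      left side into exactly the two summands on the right.\<close>
    have "4 * u * (2 * u * p) = p * (2 * u * p) + 2 * p * u"
      unfolding u[symmetric] by (simp add: algebra_simps)
    moreover have "0 < u" "u \<le> 2 * u * p"
      using u p by auto
    ultimately show ?thesis
      using is_solution_diag_iff[OF p] by blast
  qed
  then have "(\<exists>x y z. is_solution p (x, y, z) \<and> y = z) \<longleftrightarrow> [p = 3] (mod 4)"
    using cong by blast
  moreover have "real x = (real p + 1) / 4 \<and> y = 2 * x * p" if "is_solution p (x, y, y)" for x y
  proof -
    \<comment> \<open>The quotient in the claim is taken in the reals, so the natural equation is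
      cast before dividing by 4.\<close>
    have "real (4 * x) = real (p + 1)"
      using unique[OF that] by (simp only:)
    then show ?thesis
      using unique[OF that] by simp
  qed
  ultimately show ?thesis
    by simp
qed

end
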